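(* Let $\mathbf{T}\equiv(T_1,T_2)$ be a subnormal pair of operators on a complex Hilbert space $\mathcal{H}$, with normal extension $\mathbf{N}\equiv(N_1,N_2)$ acting on $\mathcal{K}\supseteq\mathcal{H}$, and write, with respect to $\mathcal{K}=\mathcal{H}\oplus\mathcal{H}^{\perp}$, $$N_i=\begin{pmatrix} T_i & A_i\\ 0 & B_i^*\end{pmatrix}\qquad(i=1,2).$$ Then $\mathbf{T}$ is spherically quasinormal if and only if $A_1^*T_1+A_2^*T_2=0$.
   Context: A pair $\mathbf{T}=(T_1,T_2)$ of bounded operators on $\mathcal{H}$ is subnormal if there are a Hilbert space $\mathcal{K}\supseteq\mathcal{H}$ and a normal pair $\mathbf{N}=(N_1,N_2)$ on $\mathcal{K}$ (i.e., $N_1N_2=N_2N_1$ and each $N_i$ is a normal operator) such that $\mathcal{H}$ is invariant under $N_1$ and $N_2$ and $T_i=N_i|_{\mathcal{H}}$ for $i=1,2$; such an $\mathbf{N}$ is called a normal extension of $\mathbf{T}$. In the matrix representation, $A_i:\mathcal{H}^\perp\to\mathcal{H}$ and $B_i:\mathcal{H}^\perp\to\mathcal{H}^\perp$ are bounded operators. A commuting pair $(T_1,T_2)$ is spherically quasinormal if each of $T_1,T_2$ commutes with $T_1^*T_1+T_2^*T_2$. *)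

theory Defs
  imports "HOL-Analysis.Analysis"
begin

text \<open>
  HOL-Analysis has real inner product spaces only. A complex Hilbert space is taken here to be a
  complete normed space whose norm comes from a sesquilinear form, linear in the first argument;
  \<open>scaleR_scaleC\<close> makes its real structure the restriction of the complex one.
\<close>

class complex_inner = real_normed_vector +
  fixes scaleC :: "complex \<Rightarrow> 'a \<Rightarrow> 'a" (infixr "*\<^sub>C" 75)
    and cinner :: "'a \<Rightarrow> 'a \<Rightarrow> complex"
  assumes scaleC_add_right: "c *\<^sub>C (x + y) = c *\<^sub>C x + c *\<^sub>C y"
    and scaleC_add_left: "(c + d) *\<^sub>C x = c *\<^sub>C x + d *\<^sub>C x"
    and scaleC_scaleC: "c *\<^sub>C d *\<^sub>C x = (c * d) *\<^sub>C x"
    and scaleC_one: "1 *\<^sub>C x = x"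
    and scaleR_scaleC: "r *\<^sub>R x = complex_of_real r *\<^sub>C x"
    and cinner_commute: "cinner x y = cnj (cinner y x)"
    and cinner_add_left: "cinner (x + y) z = cinner x z + cinner y z"
    and cinner_scaleC_left: "cinner (c *\<^sub>C x) y = c * cinner x y"
    and cinner_self: "cinner x x = complex_of_real ((norm x)\<^sup>2)"

class chilbert_space = complex_inner + complete_space

text \<open>
  The large space \<open>K\<close> is a whole type of class \<open>chilbert_space\<close>. The Hilbert spaces \<open>H\<close> and
  \<open>H\<^sup>\<bottom>\<close> inside it are closed subspaces, given as sets, and operators on or between them
  are functions on the type whose values outside the domain in question are irrelevant.
\<close>

definition closed_csubspace :: "'a::complex_inner set \<Rightarrow> bool" where
  "closed_csubspace M \<longleftrightarrow>
     0 \<in> M \<and> (\<forall>x\<in>M. \<forall>y\<in>M. x + y \<in> M) \<and> (\<forall>c. \<forall>x\<in>M. c *\<^sub>C x \<in> M) \<and> closed M"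

definition orth_compl :: "'a::complex_inner set \<Rightarrow> 'a set" where
  "orth_compl M = {y. \<forall>x\<in>M. cinner x y = 0}"

definition bounded_op :: "'a::complex_inner set \<Rightarrow> 'a set \<Rightarrow> ('a \<Rightarrow> 'a) \<Rightarrow> bool" where
  "bounded_op M L T \<longleftrightarrow>
     (\<forall>x\<in>M. T x \<in> L) \<and>
     (\<forall>x\<in>M. \<forall>y\<in>M. T (x + y) = T x + T y) \<and>
     (\<forall>c. \<forall>x\<in>M. T (c *\<^sub>C x) = c *\<^sub>C T x) \<and>
     (\<exists>b. \<forall>x\<in>M. norm (T x) \<le> b * norm x)"

text \<open>
  For a bounded operator \<open>T\<close> from the closed subspace \<open>M\<close> to the closed subspace \<open>L\<close>,
  \<open>adj M T\<close> is its Hilbert space adjoint from \<open>L\<close> to \<open>M\<close>: at \<open>y \<in> L\<close> it is the vector of \<open>M\<close>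
  given by the Riesz theorem. The codomain \<open>L\<close> matters only as the set of admissible arguments.
\<close>

definition adj :: "'a::complex_inner set \<Rightarrow> ('a \<Rightarrow> 'a) \<Rightarrow> 'a \<Rightarrow> 'a" where
  "adj M T y = (THE z. z \<in> M \<and> (\<forall>x\<in>M. cinner (T x) y = cinner x z))"

definition normal_op :: "('a::complex_inner \<Rightarrow> 'a) \<Rightarrow> bool" where
  "normal_op N \<longleftrightarrow> bounded_op UNIV UNIV N \<and> adj UNIV N \<circ> N = N \<circ> adj UNIV N"

definition normal_pair :: "('a::complex_inner \<Rightarrow> 'a) \<Rightarrow> ('a \<Rightarrow> 'a) \<Rightarrow> bool" where
  "normal_pair N1 N2 \<longleftrightarrow> normal_op N1 \<and> normal_op N2 \<and> N1 \<circ> N2 = N2 \<circ> N1"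

text \<open>
  A pair of bounded operators is subnormal iff it has a normal extension on some larger space. As
  HOL cannot quantify over the type of that space, subnormality is expressed by giving the
  extension.
\<close>

definition normal_extension ::
  "'a::complex_inner set \<Rightarrow> ('a \<Rightarrow> 'a) \<Rightarrow> ('a \<Rightarrow> 'a) \<Rightarrow> ('a \<Rightarrow> 'a) \<Rightarrow> ('a \<Rightarrow> 'a) \<Rightarrow> bool" where
  "normal_extension H T1 T2 N1 N2 \<longleftrightarrow>
     normal_pair N1 N2 \<and>
     N1 ` H \<subseteq> H \<and> N2 ` H \<subseteq> H \<and>
     (\<forall>x\<in>H. T1 x = N1 x) \<and> (\<forall>x\<in>H. T2 x = N2 x)"

text \<open>
  The operator \<open>N\<close> has the block matrix with rows \<open>(T, A)\<close> and \<open>(0, D)\<close> with respect to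
  \<open>H \<oplus> H\<^sup>\<bottom>\<close>.
\<close>

definition upper_block ::
  "'a::complex_inner set \<Rightarrow> ('a \<Rightarrow> 'a) \<Rightarrow> ('a \<Rightarrow> 'a) \<Rightarrow> ('a \<Rightarrow> 'a) \<Rightarrow> ('a \<Rightarrow> 'a) \<Rightarrow> bool" where
  "upper_block H N T A D \<longleftrightarrow>
     (\<forall>x\<in>H. \<forall>y\<in>orth_compl H. N (x + y) = (T x + A y) + D y)"

definition spherically_quasinormal ::
  "'a::complex_inner set \<Rightarrow> ('a \<Rightarrow> 'a) \<Rightarrow> ('a \<Rightarrow> 'a) \<Rightarrow> bool" where
  "spherically_quasinormal H T1 T2 \<longleftrightarrow>
     (\<forall>x\<in>H. T1 (T2 x) = T2 (T1 x)) \<and>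
     (let P = (\<lambda>x. adj H T1 (T1 x) + adj H T2 (T2 x))
      in \<forall>x\<in>H. T1 (P x) = P (T1 x) \<and> T2 (P x) = P (T2 x))"

end

theory Submission
  imports Defs "HOL-Complex_Analysis.Cauchy_Integral_Formula"
begin

text \<open>
  Put \<open>M = N\<^sub>1\<^sup>*N\<^sub>1 + N\<^sub>2\<^sup>*N\<^sub>2\<close>, \<open>P = T\<^sub>1\<^sup>*T\<^sub>1 + T\<^sub>2\<^sup>*T\<^sub>2\<close> and \<open>C = A\<^sub>1\<^sup>*T\<^sub>1 + A\<^sub>2\<^sup>*T\<^sub>2\<close>. On \<open>H\<close> the
  operator \<open>M\<close> is \<open>P + C\<close>, and \<open>M\<close> commutes with \<open>N\<^sub>1\<close> and \<open>N\<^sub>2\<close> by Fuglede's theorem. If \<open>C = 0\<close>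
  this says that \<open>P\<close> commutes with \<open>T\<^sub>1\<close> and \<open>T\<^sub>2\<close>. Conversely, if \<open>P\<close> commutes with \<open>T\<^sub>i\<close>, then
  \<open>N\<^sub>iC = CT\<^sub>i\<close> on \<open>H\<close>, whose \<open>H\<close>-component is \<open>A\<^sub>iC = 0\<close>; hence \<open>C\<^sup>*C = T\<^sub>1\<^sup>*A\<^sub>1C + T\<^sub>2\<^sup>*A\<^sub>2C = 0\<close>.

  Fuglede's theorem is proved as by Rosenblum, with \<open>exp (\<lambda>N)\<close> replaced by \<open>(1 + \<lambda>N/n)\<^sup>n\<close>, so that
  Liouville's theorem reduces to Cauchy's inequality for polynomials.
\<close>

section \<open>Complex inner product spaces\<close>

lemma scaleC_zero_left [simp]: "0 *\<^sub>C (x::'a::complex_inner) = 0"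
  using scaleR_scaleC[of 0 x] by simp

lemma scaleC_minus1: "(- 1) *\<^sub>C (x::'a::complex_inner) = - x"
  using scaleR_scaleC[of "-1" x] by simp

lemma scaleC_zero_right [simp]: "c *\<^sub>C (0::'a::complex_inner) = 0"
  using scaleC_add_right[of c 0 "0::'a"] by simp

lemma scaleC_minus_right: "c *\<^sub>C (- x) = - (c *\<^sub>C (x::'a::complex_inner))"
  using scaleC_add_right[of c x "-x"] by (simp add: eq_neg_iff_add_eq_0 add.commute)

lemma scaleC_diff_right: "c *\<^sub>C (x - y) = c *\<^sub>C x - c *\<^sub>C (y::'a::complex_inner)"
  by (metis diff_conv_add_uminus scaleC_add_right scaleC_minus_right)

lemma cinner_scaleC_right: "cinner x (c *\<^sub>C y) = cnj c * cinner x y"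
  by (metis cinner_commute cinner_scaleC_left complex_cnj_mult)

lemma cinner_add_right: "cinner x (y + z) = cinner x y + cinner x z"
  by (metis cinner_commute cinner_add_left complex_cnj_add)

lemma cinner_minus_left: "cinner (- x) y = - cinner x y"
  by (metis cinner_scaleC_left scaleC_minus1 mult_minus1)

lemma cinner_minus_right: "cinner x (- y) = - cinner x y"
  by (metis cinner_commute cinner_minus_left complex_cnj_minus)

lemma cinner_diff_left: "cinner (x - y) z = cinner x z - cinner y z"
  by (metis cinner_add_left cinner_minus_left diff_conv_add_uminus)

lemma cinner_diff_right: "cinner x (y - z) = cinner x y - cinner x z"
  by (metis cinner_add_right cinner_minus_right diff_conv_add_uminus)

lemma cinner_zero_left [simp]: "cinner 0 x = 0"
  using cinner_add_left[of 0 0 x] by simp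

lemma cinner_zero_right [simp]: "cinner x 0 = 0"
  using cinner_add_right[of x 0 0] by simp

lemma cinner_eq_zero_iff [simp]: "cinner x x = 0 \<longleftrightarrow> x = 0"
  by (simp add: cinner_self)

lemmas cinner_simps = cinner_add_left cinner_add_right cinner_diff_left cinner_diff_right
  cinner_scaleC_left cinner_scaleC_right

lemma cinner_left_eqI: "(\<And>y. cinner x y = cinner x' y) \<Longrightarrow> x = x'"
  by (metis cinner_diff_left cinner_eq_zero_iff eq_iff_diff_eq_0)

lemma norm_add_square:
  "(norm (x + y))\<^sup>2 = (norm x)\<^sup>2 + (norm y)\<^sup>2 + 2 * Re (cinner x (y::'a::complex_inner))"
proof -
  have "complex_of_real ((norm (x + y))\<^sup>2) = cinner x x + cinner y y + (cinner x y + cnj (cinner x y))"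
    by (simp add: cinner_self[symmetric] cinner_simps cinner_commute[of y x, symmetric]
        del: of_real_power)
  then have "complex_of_real ((norm (x + y))\<^sup>2)
      = complex_of_real ((norm x)\<^sup>2 + (norm y)\<^sup>2 + 2 * Re (cinner x y))"
    by (simp add: cinner_self complex_add_cnj)
  then show ?thesis
    using of_real_eq_iff by blast
qed

lemma norm_diff_square:
  "(norm (x - y))\<^sup>2 = (norm x)\<^sup>2 + (norm y)\<^sup>2 - 2 * Re (cinner x (y::'a::complex_inner))"
  using norm_add_square[of x "-y"] by (simp add: cinner_minus_right)

lemma norm_scaleC: "norm (c *\<^sub>C (x::'a::complex_inner)) = cmod c * norm x"
proof -
  have "complex_of_real ((norm (c *\<^sub>C x))\<^sup>2) = complex_of_real ((cmod c * norm x)\<^sup>2)"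
    unfolding cinner_self[symmetric] cinner_scaleC_left cinner_scaleC_right
    by (simp add: cinner_self power_mult_distrib complex_norm_square del: of_real_power)
  then have "(norm (c *\<^sub>C x))\<^sup>2 = (cmod c * norm x)\<^sup>2"
    using of_real_eq_iff by blast
  then show ?thesis by simp
qed

text \<open>Cauchy-Schwarz: by Pythagoras the orthogonal projection \<open>c *\<^sub>C y\<close> of
  \<open>x\<close> onto the line through \<open>y\<close> is no longer than
  \<open>x\<close>.\<close>

lemma norm_cinner_le: "cmod (cinner x y) \<le> norm x * norm (y::'a::complex_inner)"
proof (cases "y = 0")
  case False
  define c where "c = cinner x y / complex_of_real ((norm y)\<^sup>2)"
  have "cinner (x - c *\<^sub>C y) y = 0"
    using False by (simp add: cinner_simps cinner_self c_def)
  then have "(norm ((x - c *\<^sub>C y) + c *\<^sub>C y))\<^sup>2 = (norm (x - c *\<^sub>C y))\<^sup>2 + (norm (c *\<^sub>C y))\<^sup>2"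
    by (simp only: norm_add_square cinner_scaleC_right) simp
  then have "(norm (c *\<^sub>C y))\<^sup>2 \<le> (norm x)\<^sup>2"
    by simp
  then have "cmod c * norm y \<le> norm x"
    by (simp add: norm_scaleC)
  moreover have "cmod c * norm y = cmod (cinner x y) / norm y"
    using False by (simp add: c_def norm_divide norm_mult power2_eq_square)
  ultimately have "cmod (cinner x y) / norm y \<le> norm x" by simp
  then show ?thesis
    using False by (simp add: pos_divide_le_eq)
qed simp

lemma tendsto_cinner_right:
  assumes "(f \<longlongrightarrow> l) F"
  shows "((\<lambda>n. cinner x (f n)) \<longlongrightarrow> cinner (x::'a::complex_inner) l) F"
proof -
  have "bounded_linear (cinner x)"
  proof (rule bounded_linear_intro)
    show "norm (cinner x y) \<le> norm y * norm x" for y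
      using norm_cinner_le[of x y] by (simp add: mult.commute)
  qed (simp_all add: cinner_add_right scaleR_scaleC cinner_scaleC_right scaleR_conv_of_real)
  then show ?thesis
    using assms by (rule bounded_linear.tendsto)
qed

section \<open>Closed subspaces and orthogonal complements\<close>

lemma closed_csubspace_diff: "closed_csubspace M \<Longrightarrow> x \<in> M \<Longrightarrow> y \<in> M \<Longrightarrow> x - y \<in> M"
  unfolding closed_csubspace_def by (metis diff_conv_add_uminus scaleC_minus1)

lemma closed_csubspace_UNIV: "closed_csubspace UNIV"
  by (simp add: closed_csubspace_def)

lemma closed_csubspace_orth_compl: "closed_csubspace (orth_compl M)"
proof -
  have "closed (orth_compl M)"
    unfolding closed_sequential_limits
  proof (intro allI impI, elim conjE)
    fix s l assume s: "\<forall>n. s n \<in> orth_compl M" and "s \<longlonglongrightarrow> l"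
    have "cinner x l = 0" if "x \<in> M" for x
    proof (rule LIMSEQ_unique)
      show "(\<lambda>n. cinner x (s n)) \<longlonglongrightarrow> cinner x l"
        by (rule tendsto_cinner_right) fact
      show "(\<lambda>n. cinner x (s n)) \<longlonglongrightarrow> 0"
        using s that by (simp add: orth_compl_def)
    qed
    then show "l \<in> orth_compl M" by (simp add: orth_compl_def)
  qed
  then show ?thesis
    by (auto simp: closed_csubspace_def orth_compl_def cinner_simps)
qed

section \<open>Orthogonal projections, the Riesz theorem and adjoints\<close>

text \<open>A minimizing sequence in \<open>M\<close> is Cauchy by the parallelogram law;
  completeness gives its limit, and closedness keeps the limit in \<open>M\<close>.\<close>

lemma closest_point_exists:
  fixes M :: "'a::chilbert_space set"
  assumes M: "closed_csubspace M"
  obtains u where "u \<in> M" "\<And>m. m \<in> M \<Longrightarrow> norm (x - u) \<le> norm (x - m)"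
proof -
  define d where "d = infdist x M"
  have ne: "M \<noteq> {}" using M by (auto simp: closed_csubspace_def)
  have d0: "d \<ge> 0" by (simp add: d_def infdist_nonneg)
  have dle: "d \<le> norm (x - m)" if "m \<in> M" for m
    using infdist_le[OF that, of x] by (simp add: d_def dist_norm)
  have "\<exists>m\<in>M. dist x m < d + 1 / real (Suc n)" for n
  proof (rule ccontr)
    assume "\<not> ?thesis"
    then have "d + 1 / real (Suc n) \<le> infdist x M"
      unfolding infdist_notempty[OF ne] by (intro cINF_greatest[OF ne]) force
    then show False by (simp add: d_def)
  qed
  then obtain f where f: "\<And>n. f n \<in> M" "\<And>n. norm (x - f n) < d + 1 / real (Suc n)"
    unfolding dist_norm by metis
  \<comment> \<open>This is the parallelogram law for \<open>x - f p\<close> and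
    \<open>x - f q\<close>: the midpoint of \<open>f p\<close> and \<open>f q\<close> lies in
    \<open>M\<close>, so half of their sum has norm at least \<open>d\<close>.\<close>
  have par: "(norm (f p - f q))\<^sup>2 \<le> 2 * (norm (x - f p))\<^sup>2 + 2 * (norm (x - f q))\<^sup>2 - 4 * d\<^sup>2" for p q
  proof -
    define a b where "a = x - f p" and "b = x - f q"
    have "(1/2) *\<^sub>R (f p + f q) \<in> M"
      using M f(1) by (simp add: closed_csubspace_def scaleR_scaleC)
    then have "d \<le> norm (x - (1/2) *\<^sub>R (f p + f q))" by (rule dle)
    also have "x - (1/2) *\<^sub>R (f p + f q) = (1/2) *\<^sub>R (a + b)"
      by (simp add: a_def b_def scaleR_right_diff_distrib scaleR_right_distrib)
         (metis field_sum_of_halves scaleR_add_left scaleR_one)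
    finally have "2 * d \<le> norm (a + b)" by simp
    then have "4 * d\<^sup>2 \<le> (norm (a + b))\<^sup>2"
      using power_mono[of "2*d" "norm (a+b)" 2] d0 by (simp add: power_mult_distrib)
    moreover have "(norm (b - a))\<^sup>2 = 2 * (norm a)\<^sup>2 + 2 * (norm b)\<^sup>2 - (norm (a + b))\<^sup>2"
      using norm_add_square[of b a] norm_diff_square[of b a] by (simp add: add.commute)
    moreover have "b - a = f p - f q" by (simp add: a_def b_def)
    ultimately show ?thesis by (simp add: a_def b_def)
  qed
  have "Cauchy f"
  proof (rule metric_CauchyI)
    fix e :: real assume e: "e > 0"
    have "(\<lambda>n. 4 * (d + 1 / real (Suc n))\<^sup>2 - 4 * d\<^sup>2) \<longlonglongrightarrow> 4 * (d + 0)\<^sup>2 - 4 * d\<^sup>2"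
      by (intro tendsto_intros LIMSEQ_inverse_real_of_nat[unfolded inverse_eq_divide])
    then have "eventually (\<lambda>n. 4 * (d + 1 / real (Suc n))\<^sup>2 - 4 * d\<^sup>2 < e\<^sup>2) sequentially"
      using e by (intro order_tendstoD(2)) auto
    then obtain n0 where n0: "\<And>n. n \<ge> n0 \<Longrightarrow> 4 * (d + 1 / real (Suc n))\<^sup>2 - 4 * d\<^sup>2 < e\<^sup>2"
      unfolding eventually_sequentially by blast
    have near: "4 * (norm (x - f n))\<^sup>2 - 4 * d\<^sup>2 < e\<^sup>2" if "n \<ge> n0" for n
      using power_mono[of "norm (x - f n)" "d + 1 / real (Suc n)" 2] f(2)[of n] n0[OF that]
      by simp
    show "\<exists>n0. \<forall>p\<ge>n0. \<forall>q\<ge>n0. dist (f p) (f q) < e"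
    proof (intro exI allI impI)
      fix p q assume "n0 \<le> p" "n0 \<le> q"
      then have "(norm (f p - f q))\<^sup>2 < e\<^sup>2"
        using par[of p q] near[of p] near[of q] by linarith
      then show "dist (f p) (f q) < e"
        using e by (simp add: dist_norm power_less_imp_less_base)
    qed
  qed
  then obtain u where u: "f \<longlonglongrightarrow> u"
    using Cauchy_convergent convergent_def by blast
  have "u \<in> M"
    using M f(1) u unfolding closed_csubspace_def closed_sequential_limits by blast
  moreover have "norm (x - u) \<le> d"
  proof (rule LIMSEQ_le)
    show "(\<lambda>n. norm (x - f n)) \<longlonglongrightarrow> norm (x - u)"
      by (intro tendsto_intros u)
    show "(\<lambda>n. d + 1 / real (Suc n)) \<longlonglongrightarrow> d"
      using tendsto_add[OF tendsto_const LIMSEQ_inverse_real_of_nat, of d]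
      by (simp add: inverse_eq_divide)
    show "\<exists>N. \<forall>n\<ge>N. norm (x - f n) \<le> d + 1 / real (Suc n)"
      using f(2) less_imp_le by blast
  qed
  ultimately show thesis
    using that dle order_trans by blast
qed

text \<open>With \<open>u\<close> closest to \<open>x\<close>, the rest \<open>v = x - u\<close> has
  no component along any \<open>m\<close> in \<open>M\<close>, because adding that component to
  \<open>u\<close> would give a strictly closer point.\<close>

lemma orthogonal_decomposition:
  fixes M :: "'a::chilbert_space set"
  assumes M: "closed_csubspace M"
  obtains u v where "u \<in> M" "v \<in> orth_compl M" "x = u + v"
proof -
  obtain u where u: "u \<in> M" "\<And>m. m \<in> M \<Longrightarrow> norm (x - u) \<le> norm (x - m)"
    using closest_point_exists[OF M] by metis
  define v where "v = x - u"
  have "cinner m v = 0" if m: "m \<in> M" for m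
  proof (cases "m = 0")
    case False
    define c where "c = cinner v m / complex_of_real ((norm m)\<^sup>2)"
    have orth: "cinner (v - c *\<^sub>C m) m = 0"
      using False by (simp add: cinner_simps cinner_self c_def)
    have "u + c *\<^sub>C m \<in> M"
      using M u(1) m by (simp add: closed_csubspace_def)
    from u(2)[OF this] have "norm v \<le> norm (v - c *\<^sub>C m)"
      by (simp add: v_def algebra_simps)
    then have "(norm v)\<^sup>2 \<le> (norm (v - c *\<^sub>C m))\<^sup>2"
      by (simp add: power_mono)
    moreover have "(norm ((v - c *\<^sub>C m) + c *\<^sub>C m))\<^sup>2 = (norm (v - c *\<^sub>C m))\<^sup>2 + (norm (c *\<^sub>C m))\<^sup>2"
      by (simp only: norm_add_square cinner_scaleC_right orth) simp
    moreover have "(v - c *\<^sub>C m) + c *\<^sub>C m = v" by simp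
    ultimately have "(norm (c *\<^sub>C m))\<^sup>2 \<le> 0" by (metis add_le_same_cancel1)
    then have "norm (c *\<^sub>C m) = 0" by simp
    then have "cinner v m = 0" using False by (simp add: norm_scaleC c_def)
    then show ?thesis by (metis cinner_commute complex_cnj_zero)
  qed simp
  then have "v \<in> orth_compl M" by (simp add: orth_compl_def)
  then show thesis
    using that u(1) by (simp add: v_def)
qed

text \<open>The kernel \<open>Z\<close> of \<open>f\<close> in \<open>M\<close> is closed. A vector
  \<open>v\<close> of \<open>M\<close> orthogonal to \<open>Z\<close> with
  \<open>f v \<noteq> 0\<close> spans \<open>M\<close> modulo \<open>Z\<close>, so a multiple of
  \<open>v\<close> represents \<open>f\<close>.\<close>

lemma riesz_representation:
  fixes M :: "'a::chilbert_space set"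
  assumes M: "closed_csubspace M"
    and add: "\<And>x y. x \<in> M \<Longrightarrow> y \<in> M \<Longrightarrow> f (x + y) = f x + f y"
    and scale: "\<And>c x. x \<in> M \<Longrightarrow> f (c *\<^sub>C x) = c * f x"
    and bdd: "\<And>x. x \<in> M \<Longrightarrow> cmod (f x) \<le> b * norm x"
  obtains z where "z \<in> M" "\<And>x. x \<in> M \<Longrightarrow> f x = cinner x z"
proof (cases "\<forall>x\<in>M. f x = 0")
  case True
  then show ?thesis using that[of 0] M by (auto simp: closed_csubspace_def)
next
  case False
  then obtain x0 where x0: "x0 \<in> M" "f x0 \<noteq> 0" by blast
  define Z where "Z = {x\<in>M. f x = 0}"
  have f0: "f 0 = 0" using scale[of 0 0] M by (simp add: closed_csubspace_def)
  have fdiff: "f (x - y) = f x - f y" if "x \<in> M" "y \<in> M" for x y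
    using add[OF closed_csubspace_diff[OF M that] that(2)] by simp
  have "closed Z"
    unfolding closed_sequential_limits
  proof (intro allI impI, elim conjE)
    fix s l assume s: "\<forall>n. s n \<in> Z" and l: "s \<longlonglongrightarrow> l"
    have lM: "l \<in> M"
      using M s l unfolding closed_csubspace_def closed_sequential_limits Z_def by blast
    have "cmod (f l) \<le> b * norm (l - s n)" for n
      using bdd[OF closed_csubspace_diff[OF M lM, of "s n"]] fdiff[OF lM, of "s n"] s
      by (simp add: Z_def)
    moreover have "(\<lambda>n. b * norm (l - s n)) \<longlonglongrightarrow> b * norm (l - l)"
      by (intro tendsto_intros l)
    ultimately have "cmod (f l) \<le> b * norm (l - l)"
      by (intro LIMSEQ_le_const) auto
    then show "l \<in> Z" using lM by (simp add: Z_def)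
  qed
  then have Z: "closed_csubspace Z"
    using M by (auto simp: closed_csubspace_def Z_def add scale f0)
  obtain u v where uv: "u \<in> Z" "v \<in> orth_compl Z" "x0 = u + v"
    using orthogonal_decomposition[OF Z] by metis
  have uM: "u \<in> M" and "f u = 0" using uv(1) by (auto simp: Z_def)
  have v: "v = x0 - u" using uv(3) by simp
  have vM: "v \<in> M" unfolding v by (rule closed_csubspace_diff[OF M x0(1) uM])
  have fv: "f v \<noteq> 0" using fdiff[OF x0(1) uM] x0(2) \<open>f u = 0\<close> v by simp
  then have v0: "v \<noteq> 0" using f0 by auto
  \<comment> \<open>The scalar is forced by \<open>f v = cinner v z\<close>; it is conjugated
    because \<open>cinner\<close> is antilinear in its second argument.\<close>
  define z where "z = (cnj (f v) / complex_of_real ((norm v)\<^sup>2)) *\<^sub>C v"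
  show ?thesis
  proof (rule that[of z])
    show "z \<in> M" using M vM by (simp add: z_def closed_csubspace_def)
    fix x assume x: "x \<in> M"
    have cv: "(f x / f v) *\<^sub>C v \<in> M" using M vM by (simp add: closed_csubspace_def)
    have "x - (f x / f v) *\<^sub>C v \<in> Z"
      using closed_csubspace_diff[OF M x cv] fdiff[OF x cv] scale[OF vM] fv by (simp add: Z_def)
    then have "cinner (x - (f x / f v) *\<^sub>C v) v = 0"
      using uv(2) by (simp add: orth_compl_def)
    then have "cinner x v = f x / f v * complex_of_real ((norm v)\<^sup>2)"
      by (simp add: cinner_simps cinner_self)
    then show "f x = cinner x z"
      using fv v0 by (simp add: z_def cinner_simps)
  qed
qed

text \<open>As \<open>adj\<close> is a definite description, its properties need existence, which is
  the Riesz theorem, and uniqueness: the difference of two candidates lies in \<open>M\<close> and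
  is orthogonal to itself.\<close>

lemma
  fixes M :: "'a::chilbert_space set"
  assumes M: "closed_csubspace M" and T: "bounded_op M L T"
  shows adj_in: "adj M T y \<in> M"
    and cinner_adj: "x \<in> M \<Longrightarrow> cinner (T x) y = cinner x (adj M T y)"
proof -
  have "\<exists>b. \<forall>x\<in>M. norm (T x) \<le> b * norm x"
    using T by (simp add: bounded_op_def)
  then obtain b where b: "\<And>x. x \<in> M \<Longrightarrow> norm (T x) \<le> b * norm x"
    by blast
  obtain z where z: "z \<in> M" "\<And>x. x \<in> M \<Longrightarrow> cinner (T x) y = cinner x z"
  proof (rule riesz_representation[OF M, of "\<lambda>x. cinner (T x) y" "b * norm y"])
    fix x assume "x \<in> M"
    then have "norm (T x) * norm y \<le> b * norm x * norm y"
      by (intro mult_right_mono b) auto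
    then show "cmod (cinner (T x) y) \<le> b * norm y * norm x"
      using norm_cinner_le[of "T x" y] by (simp add: mult.assoc mult.left_commute mult.commute)
  qed (use T in \<open>auto simp: bounded_op_def cinner_simps\<close>)
  have uniq: "w = z" if "w \<in> M" "\<forall>x\<in>M. cinner (T x) y = cinner x w" for w
  proof -
    have "cinner (w - z) (w - z) = 0"
      using that z closed_csubspace_diff[OF M that(1) z(1)] by (simp add: cinner_diff_right)
    then show ?thesis by simp
  qed
  have "adj M T y = z"
    unfolding adj_def
  proof (rule the_equality)
    show "z \<in> M \<and> (\<forall>x\<in>M. cinner (T x) y = cinner x z)"
      using z by blast
  qed (use uniq in blast)
  then have "adj M T y \<in> M \<and> (\<forall>x\<in>M. cinner (T x) y = cinner x (adj M T y))"
    using z by blast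
  then show "adj M T y \<in> M" "x \<in> M \<Longrightarrow> cinner (T x) y = cinner x (adj M T y)"
    by auto
qed

lemma orth_compl_disjoint: "x \<in> M \<Longrightarrow> x \<in> orth_compl M \<Longrightarrow> x = 0"
  unfolding orth_compl_def by auto

section \<open>Bounded operators and their adjoints on the whole space\<close>

lemma bounded_op_bound:
  assumes "bounded_op M L T"
  obtains b where "b \<ge> 0" "\<And>x. x \<in> M \<Longrightarrow> norm (T x) \<le> b * norm x"
proof -
  have "\<exists>b. \<forall>x\<in>M. norm (T x) \<le> b * norm x"
    using assms by (simp add: bounded_op_def)
  then obtain b where b: "\<And>x. x \<in> M \<Longrightarrow> norm (T x) \<le> b * norm x"
    by blast
  have "norm (T x) \<le> \<bar>b\<bar> * norm x" if "x \<in> M" for x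
    using b[OF that] by (meson abs_ge_self mult_right_mono norm_ge_zero order_trans)
  then show thesis
    using that[of "\<bar>b\<bar>"] by simp
qed

lemma
  assumes "bounded_op UNIV UNIV T"
  shows bounded_op_add: "T (x + y) = T x + T y"
    and bounded_op_scaleC: "T (c *\<^sub>C x) = c *\<^sub>C T x"
    and bounded_op_diff: "T (x - y) = T x - T y"
proof -
  show add: "T (x + y) = T x + T y" for x y
    using assms by (simp add: bounded_op_def)
  show "T (c *\<^sub>C x) = c *\<^sub>C T x"
    using assms by (simp add: bounded_op_def)
  show "T (x - y) = T x - T y"
    using add[of "x - y" y] by simp
qed

lemma cinner_adj_UNIV:
  fixes T :: "'a::chilbert_space \<Rightarrow> 'a"
  assumes "bounded_op UNIV UNIV T"
  shows "cinner (T x) y = cinner x (adj UNIV T y)"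
  using cinner_adj[OF closed_csubspace_UNIV assms] by simp

text \<open>Apply Cauchy-Schwarz to the inner product of \<open>T z\<close> and \<open>y\<close> for
  \<open>z = adj UNIV T y\<close>, which equals the square of the norm of \<open>z\<close>, and
  cancel one factor.\<close>

lemma norm_adj_UNIV_le:
  fixes T :: "'a::chilbert_space \<Rightarrow> 'a"
  assumes T: "bounded_op UNIV UNIV T" and b: "\<And>x. norm (T x) \<le> b * norm x"
  shows "norm (adj UNIV T y) \<le> b * norm y"
proof (cases "adj UNIV T y = 0")
  case True
  have "0 \<le> b * norm y" using b[of y] norm_ge_zero order_trans by blast
  then show ?thesis using True by simp
next
  case False
  let ?z = "adj UNIV T y"
  have "(norm ?z)\<^sup>2 = cmod (cinner (T ?z) y)"
    by (simp add: cinner_adj_UNIV[OF T] cinner_self norm_power)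
  also have "\<dots> \<le> norm (T ?z) * norm y" by (rule norm_cinner_le)
  also have "\<dots> \<le> b * norm ?z * norm y" by (intro mult_right_mono b) simp
  finally show ?thesis using False by (simp add: power2_eq_square)
qed

lemma bounded_op_adj_UNIV:
  fixes T :: "'a::chilbert_space \<Rightarrow> 'a"
  assumes T: "bounded_op UNIV UNIV T"
  shows "bounded_op UNIV UNIV (adj UNIV T)"
proof -
  have eq: "z = z'" if "\<And>x. cinner x z = cinner x (z'::'a)" for z z'
    by (rule cinner_left_eqI) (metis that cinner_commute)
  have "adj UNIV T (x + y) = adj UNIV T x + adj UNIV T y" for x y
    by (rule eq) (simp add: cinner_adj_UNIV[OF T, symmetric] cinner_simps)
  moreover have "adj UNIV T (c *\<^sub>C x) = c *\<^sub>C adj UNIV T x" for c x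
    by (rule eq) (simp add: cinner_adj_UNIV[OF T, symmetric] cinner_simps)
  moreover obtain b where "\<And>x. norm (T x) \<le> b * norm x"
    using bounded_op_bound[OF T] by auto
  then have "\<exists>b. \<forall>y. norm (adj UNIV T y) \<le> b * norm y"
    using norm_adj_UNIV_le[OF T] by blast
  ultimately show ?thesis by (simp add: bounded_op_def)
qed

section \<open>Fuglede's theorem\<close>

lemma funpow_norm_le:
  fixes f :: "'a::real_normed_vector \<Rightarrow> 'a"
  assumes "\<And>x. norm (f x) \<le> b * norm x" "b \<ge> 0"
  shows "norm ((f ^^ n) x) \<le> b ^ n * norm x"
proof (induction n)
  case (Suc n)
  have "norm ((f ^^ Suc n) x) \<le> b * norm ((f ^^ n) x)" using assms by simp
  also have "\<dots> \<le> b * (b ^ n * norm x)" by (intro mult_left_mono Suc assms)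
  finally show ?case by (simp add: mult.assoc)
qed simp

lemma funpow_commute:
  assumes "\<And>x. f (g x) = g (f x)"
  shows "(f ^^ n) (g x) = g ((f ^^ n) x)"
  by (induction n) (simp_all add: assms)

lemma funpow_comp_commute:
  assumes "\<And>x. f (g x) = g (f x)"
  shows "((f \<circ> g) ^^ n) x = (f ^^ n) ((g ^^ n) x)"
  by (induction n) (simp_all add: funpow_commute[of f g, OF assms])

text \<open>One more application moves the iterate by at most \<open>e\<close> times its norm, which
  is at most \<open>(1 + e) ^ n * norm x\<close>; these moves add up to a geometric sum.\<close>

lemma funpow_near_id:
  fixes f :: "'a::real_normed_vector \<Rightarrow> 'a"
  assumes e: "\<And>x. norm (f x - x) \<le> e * norm x" "e \<ge> 0"
  shows "norm ((f ^^ n) x - x) \<le> ((1 + e) ^ n - 1) * norm x"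
proof (induction n)
  case (Suc n)
  let ?y = "(f ^^ n) x"
  have "norm ?y \<le> norm (?y - x) + norm x" using norm_triangle_ineq[of "?y - x" x] by simp
  also have "\<dots> \<le> (1 + e) ^ n * norm x" using Suc by (simp add: algebra_simps)
  finally have "e * norm ?y \<le> e * ((1 + e) ^ n * norm x)"
    by (rule mult_left_mono) (rule e(2))
  moreover have "norm (f ?y - x) \<le> norm (f ?y - ?y) + norm (?y - x)"
    using norm_triangle_ineq[of "f ?y - ?y" "?y - x"] by simp
  ultimately show ?case
    using e(1)[of ?y] Suc by (simp add: algebra_simps)
qed simp

lemma cinner_funpow:
  fixes f g :: "'a::complex_inner \<Rightarrow> 'a"
  assumes "\<And>x y. cinner (f x) y = cinner x (g y)"
  shows "cinner ((f ^^ n) x) y = cinner x ((g ^^ n) y)"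
  by (induction n arbitrary: x y) (simp_all add: assms funpow_swap1)

text \<open>The second argument is antilinear, so \<open>cnj a\<close> there makes the expression a
  polynomial in \<open>a\<close>. For \<open>k = m = n\<close> its linear coefficient is
  \<open>n\<close> times the matrix entry of a commutator of \<open>T\<close> with
  \<open>N'\<close>, once \<open>N'\<close> is the adjoint of \<open>N\<close>.\<close>

lemma cinner_funpow_poly:
  fixes N N' T :: "'a::complex_inner \<Rightarrow> 'a"
  assumes N: "bounded_op UNIV UNIV N" and N': "bounded_op UNIV UNIV N'"
    and T: "bounded_op UNIV UNIV T"
  shows "\<exists>p. (\<forall>a. poly p a =
        cinner (T (((\<lambda>x. x - a *\<^sub>C N' x) ^^ k) x)) (((\<lambda>x. x + cnj a *\<^sub>C N x) ^^ m) y))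
      \<and> coeff p 0 = cinner (T x) y
      \<and> coeff p 1 = of_nat m * cinner (T x) (N y) - of_nat k * cinner (T (N' x)) y"
proof (induction k arbitrary: x)
  case 0
  show ?case
  proof (induction m arbitrary: y)
    case 0
    show ?case by (rule exI[of _ "[:cinner (T x) y:]"]) simp
  next
    case (Suc m)
    obtain p where p: "\<And>a. poly p a = cinner (T x) (((\<lambda>x. x + cnj a *\<^sub>C N x) ^^ m) y)"
      "coeff p 0 = cinner (T x) y" "coeff p 1 = of_nat m * cinner (T x) (N y)"
      using Suc[of y] by auto
    obtain q where q: "\<And>a. poly q a = cinner (T x) (((\<lambda>x. x + cnj a *\<^sub>C N x) ^^ m) (N y))"
      "coeff q 0 = cinner (T x) (N y)"
      using Suc[of "N y"] by auto
    \<comment> \<open>A further factor contributes \<open>a\<close> times the same expression with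
      \<open>N y\<close> in place of \<open>y\<close>, so the polynomial \<open>q\<close> for
      \<open>N y\<close> is shifted by \<open>pCons 0\<close>.\<close>
    have comm: "((\<lambda>x. x + cnj a *\<^sub>C N x) ^^ m) (N y) = N (((\<lambda>x. x + cnj a *\<^sub>C N x) ^^ m) y)" for a
      by (rule funpow_commute) (simp add: bounded_op_add[OF N] bounded_op_scaleC[OF N])
    show ?case
      by (rule exI[of _ "p + pCons 0 q"])
         (simp add: p q[unfolded comm] cinner_simps algebra_simps p(3)[unfolded One_nat_def])
  qed
next
  case (Suc k)
  let ?w = "\<lambda>a. ((\<lambda>x. x + cnj a *\<^sub>C N x) ^^ m) y"
  obtain p where p: "\<And>a. poly p a = cinner (T (((\<lambda>x. x - a *\<^sub>C N' x) ^^ k) x)) (?w a)"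
    "coeff p 0 = cinner (T x) y"
    "coeff p 1 = of_nat m * cinner (T x) (N y) - of_nat k * cinner (T (N' x)) y"
    using Suc[of x] by blast
  obtain q where q: "\<And>a. poly q a = cinner (T (((\<lambda>x. x - a *\<^sub>C N' x) ^^ k) (N' x))) (?w a)"
    "coeff q 0 = cinner (T (N' x)) y"
    using Suc[of "N' x"] by blast
  have comm: "((\<lambda>x. x - a *\<^sub>C N' x) ^^ k) (N' x) = N' (((\<lambda>x. x - a *\<^sub>C N' x) ^^ k) x)" for a
    by (rule funpow_commute) (simp add: bounded_op_diff[OF N'] bounded_op_scaleC[OF N'])
  show ?case
    by (rule exI[of _ "p - pCons 0 q"])
       (simp add: p q[unfolded comm] cinner_simps algebra_simps p(3)[unfolded One_nat_def]
          bounded_op_diff[OF T] bounded_op_scaleC[OF T])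
qed

text \<open>
  With \<open>Q = 1 - aN\<^sup>*\<close> and \<open>R = 1 + (cnj a)N\<close>, the operator \<open>QR\<close> is unitary up to second order in
  \<open>a\<close>, and \<open>(1 - (cnj a)N)R\<close> is the identity up to second order in \<open>a\<close>. As \<open>T\<close> commutes with \<open>N\<close>,
  this compares the inner product of \<open>TQ\<^sup>nx\<close> and \<open>R\<^sup>ny\<close> with that of \<open>T(QR)\<^sup>nx\<close> and \<open>(QR)\<^sup>ny\<close>.
\<close>

lemma fuglede_estimate:
  fixes N N' T :: "'a::complex_inner \<Rightarrow> 'a"
  assumes N: "bounded_op UNIV UNIV N" and N': "bounded_op UNIV UNIV N'"
    and T: "bounded_op UNIV UNIV T"
    and adj: "\<And>x y. cinner (N x) y = cinner x (N' y)"
    and normal: "\<And>x. N' (N x) = N (N' x)"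
    and TN: "\<And>x. T (N x) = N (T x)"
    and c: "c \<ge> 0" "\<And>x. norm (N x) \<le> c * norm x" "\<And>x. norm (N' x) \<le> c * norm x"
    and t: "t \<ge> 0" "\<And>x. norm (T x) \<le> t * norm x"
  fixes a defines "r \<equiv> cmod a * c"
  shows "cmod (cinner (T (((\<lambda>x. x - a *\<^sub>C N' x) ^^ n) x)) (((\<lambda>x. x + cnj a *\<^sub>C N x) ^^ n) y))
    \<le> t * norm x * norm y * (((1 + 3 * r\<^sup>2) ^ n)\<^sup>2 + ((1 + r) ^ n)\<^sup>2 * ((1 + r\<^sup>2) ^ n - 1))"
proof -
  \<comment> \<open>\<open>P\<close> is the adjoint of \<open>Q\<close>; it carries powers of
    \<open>Q\<close> from the second argument of \<open>cinner\<close> to the first.\<close>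
  define P where "P = (\<lambda>x. x - cnj a *\<^sub>C N x)"
  define Q where "Q = (\<lambda>x. x - a *\<^sub>C N' x)"
  define R where "R = (\<lambda>x. x + cnj a *\<^sub>C N x)"
  note linear = bounded_op_add[OF N] bounded_op_diff[OF N] bounded_op_scaleC[OF N]
    bounded_op_add[OF N'] bounded_op_diff[OF N'] bounded_op_scaleC[OF N']
    bounded_op_add[OF T] bounded_op_diff[OF T] bounded_op_scaleC[OF T]
  note scale = scaleC_add_right scaleC_diff_right scaleC_scaleC
  have QR: "Q (R x) = R (Q x)" and PR: "P (R x) = R (P x)" and PQ: "P (Q x) = Q (P x)"
    and TP: "T (P x) = P (T x)" and TR: "T (R x) = R (T x)" for x
    unfolding P_def Q_def R_def by (simp_all add: linear normal TN scale algebra_simps)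
  have PRid: "P (R x) - x = - ((cnj a * cnj a) *\<^sub>C N (N x))" for x
    unfolding P_def R_def by (simp add: linear scale algebra_simps)
  have r0: "r \<ge> 0" using c(1) by (simp add: r_def)
  have aN: "norm (cnj a *\<^sub>C N x) \<le> r * norm x" and aN': "norm (a *\<^sub>C N' x) \<le> r * norm x" for x
    using mult_left_mono[OF c(2)[of x], of "cmod a"] mult_left_mono[OF c(3)[of x], of "cmod a"]
    by (simp_all add: norm_scaleC r_def mult.assoc)
  have nQ: "norm (Q x) \<le> (1 + r) * norm x" for x
    using norm_triangle_ineq4[of x "a *\<^sub>C N' x"] aN'[of x] by (simp add: Q_def algebra_simps)
  have nR: "norm (R x) \<le> (1 + r) * norm x" for x
    using norm_triangle_ineq[of x "cnj a *\<^sub>C N x"] aN[of x] by (simp add: R_def algebra_simps)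
  have nPR: "norm ((P \<circ> R) x - x) \<le> r\<^sup>2 * norm x" for x
  proof -
    have "norm ((P \<circ> R) x - x) = norm (cnj a *\<^sub>C N (cnj a *\<^sub>C N x))"
      by (simp add: PRid linear scaleC_scaleC)
    also have "\<dots> \<le> r * (r * norm x)"
      by (rule order_trans[OF aN]) (intro mult_left_mono aN r0)
    finally show ?thesis by (simp add: power2_eq_square mult.assoc)
  qed
  have nQR: "norm ((Q \<circ> R) x) \<le> (1 + 3 * r\<^sup>2) * norm x" for x
  proof -
    \<comment> \<open>Here \<open>QR = 1 + z - w\<close>, where \<open>z\<close> is the skew-adjoint
      first-order part and \<open>w\<close> is of second order. Skewness makes \<open>z\<close> at
      \<open>x\<close> orthogonal to \<open>x\<close> in the real sense, so by Pythagoras it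
      enlarges the norm only to second order.\<close>
    define z where "z = cnj a *\<^sub>C N x - a *\<^sub>C N' x"
    define w where "w = a *\<^sub>C N' (cnj a *\<^sub>C N x)"
    have "cinner x (N' x) = cnj (cinner x (N x))"
      by (metis adj cinner_commute)
    then have "Re (cinner x z) = 0"
      unfolding z_def by (simp add: cinner_simps)
    then have "(norm (x + z))\<^sup>2 = (norm x)\<^sup>2 + (norm z)\<^sup>2"
      by (simp add: norm_add_square)
    moreover have "norm z \<le> 2 * r * norm x"
      unfolding z_def using norm_triangle_ineq4[of "cnj a *\<^sub>C N x" "a *\<^sub>C N' x"] aN[of x] aN'[of x]
      by simp
    then have "(norm z)\<^sup>2 \<le> (2 * r * norm x)\<^sup>2" by (simp add: power_mono)
    moreover have "(norm x)\<^sup>2 + (2 * r * norm x)\<^sup>2 \<le> ((1 + 2 * r\<^sup>2) * norm x)\<^sup>2"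
      using zero_le_power2[of "2 * r\<^sup>2 * norm x"] by (simp add: power2_eq_square algebra_simps)
    ultimately have "(norm (x + z))\<^sup>2 \<le> ((1 + 2 * r\<^sup>2) * norm x)\<^sup>2" by linarith
    then have "norm (x + z) \<le> (1 + 2 * r\<^sup>2) * norm x"
      by (rule power2_le_imp_le) simp
    moreover have "norm w \<le> r * (r * norm x)"
      unfolding w_def by (rule order_trans[OF aN']) (intro mult_left_mono aN r0)
    moreover have "(Q \<circ> R) x = (x + z) - w"
      by (simp add: Q_def R_def z_def w_def linear scale algebra_simps)
    then have "norm ((Q \<circ> R) x) \<le> norm (x + z) + norm w"
      by (metis norm_triangle_ineq4)
    ultimately show ?thesis
      by (simp add: power2_eq_square algebra_simps)
  qed
  have P_adj: "cinner (P x) y = cinner x (Q y)" for x y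
    by (simp add: P_def Q_def cinner_simps adj)
  have T_comm: "T ((P ^^ n) x) = (P ^^ n) (T x)" "T ((R ^^ n) x) = (R ^^ n) (T x)" for x
    using funpow_commute[of P T] funpow_commute[of R T] TP TR by simp_all
  have Q_comm: "(Q ^^ n) ((P ^^ n) x) = (P ^^ n) ((Q ^^ n) x)"
    "(Q ^^ n) ((R ^^ n) x) = (R ^^ n) ((Q ^^ n) x)" for x
    by (metis funpow_commute PQ) (metis funpow_commute QR)
  have PR_comp: "((P \<circ> R) ^^ n) x = (P ^^ n) ((R ^^ n) x)" for x
    by (rule funpow_comp_commute) (rule PR)
  have QR_comp: "((Q \<circ> R) ^^ n) x = (R ^^ n) ((Q ^^ n) x)" for x
    using funpow_comp_commute[of Q R, OF QR] Q_comm(2) by simp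
  define e where "e = ((P \<circ> R) ^^ n) x - x"
  have Qdiff: "(Q ^^ n) (u - v) = (Q ^^ n) u - (Q ^^ n) v" for u v
  proof (induction n)
    case (Suc n)
    have "Q (u' - v') = Q u' - Q v'" for u' v'
      by (simp add: Q_def linear scale algebra_simps)
    then show ?case by (simp add: Suc)
  qed simp
  \<comment> \<open>Since \<open>T\<close> commutes with \<open>R\<close>, the powers of
    \<open>R\<close> can be taken out of \<open>T\<close>; the powers of \<open>Q\<close> in the
    second argument come over as powers of \<open>P\<close>. They meet in
    \<open>(P \<circ> R) ^^ n\<close>, which maps \<open>x\<close> to \<open>x + e\<close>.\<close>
  have main: "cinner (T (((Q \<circ> R) ^^ n) x)) (((Q \<circ> R) ^^ n) y)
      = cinner (T ((Q ^^ n) x)) ((R ^^ n) y) + cinner (T ((Q ^^ n) e)) ((R ^^ n) y)"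
  proof -
    have "cinner (T (((Q \<circ> R) ^^ n) x)) (((Q \<circ> R) ^^ n) y)
        = cinner ((R ^^ n) (T ((Q ^^ n) x))) ((Q ^^ n) ((R ^^ n) y))"
      unfolding QR_comp T_comm Q_comm ..
    also have "\<dots> = cinner ((P ^^ n) ((R ^^ n) (T ((Q ^^ n) x)))) ((R ^^ n) y)"
      by (rule cinner_funpow[symmetric]) (rule P_adj)
    also have "(P ^^ n) ((R ^^ n) (T ((Q ^^ n) x))) = T ((Q ^^ n) (((P \<circ> R) ^^ n) x))"
      unfolding PR_comp T_comm Q_comm ..
    also have "\<dots> = T ((Q ^^ n) x) + T ((Q ^^ n) e)"
      by (simp add: e_def Qdiff linear)
    finally show ?thesis by (simp only: cinner_add_left)
  qed
  have bound: "cmod (cinner (T u) v) \<le> t * norm u * norm v" for u v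
    using norm_cinner_le[of "T u" v] mult_right_mono[OF t(2)[of u], of "norm v"] by simp
  have "cmod (cinner (T (((Q \<circ> R) ^^ n) x)) (((Q \<circ> R) ^^ n) y))
      \<le> t * ((1 + 3 * r\<^sup>2) ^ n * norm x) * ((1 + 3 * r\<^sup>2) ^ n * norm y)"
    by (rule order_trans[OF bound])
       (intro mult_mono mult_nonneg_nonneg funpow_norm_le nQR order_refl; simp add: t)
  moreover have "norm e \<le> ((1 + r\<^sup>2) ^ n - 1) * norm x"
    unfolding e_def by (rule funpow_near_id[OF nPR]) simp
  then have "(1 + r) ^ n * norm e \<le> (1 + r) ^ n * (((1 + r\<^sup>2) ^ n - 1) * norm x)"
    by (rule mult_left_mono) (use r0 in simp)
  then have "norm ((Q ^^ n) e) \<le> (1 + r) ^ n * (((1 + r\<^sup>2) ^ n - 1) * norm x)"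
    using funpow_norm_le[of Q, OF nQ, of n e] r0 by linarith
  then have "cmod (cinner (T ((Q ^^ n) e)) ((R ^^ n) y))
      \<le> t * ((1 + r) ^ n * (((1 + r\<^sup>2) ^ n - 1) * norm x)) * ((1 + r) ^ n * norm y)"
    by (intro order_trans[OF bound] mult_mono mult_nonneg_nonneg funpow_norm_le nR order_refl)
       (simp_all add: t r0 one_le_power)
  moreover have "cmod (cinner (T ((Q ^^ n) x)) ((R ^^ n) y))
      \<le> cmod (cinner (T (((Q \<circ> R) ^^ n) x)) (((Q \<circ> R) ^^ n) y))
        + cmod (cinner (T ((Q ^^ n) e)) ((R ^^ n) y))"
    unfolding main by (metis add_diff_cancel_right' norm_triangle_ineq4)
  ultimately have "cmod (cinner (T ((Q ^^ n) x)) ((R ^^ n) y))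
      \<le> t * ((1 + 3 * r\<^sup>2) ^ n * norm x) * ((1 + 3 * r\<^sup>2) ^ n * norm y)
        + t * ((1 + r) ^ n * (((1 + r\<^sup>2) ^ n - 1) * norm x)) * ((1 + r) ^ n * norm y)"
    by linarith
  also have "\<dots> = t * norm x * norm y
      * (((1 + 3 * r\<^sup>2) ^ n)\<^sup>2 + ((1 + r) ^ n)\<^sup>2 * ((1 + r\<^sup>2) ^ n - 1))"
    by (simp only: power2_eq_square[of "_ ^ n"]) (simp only: algebra_simps)
  finally show ?thesis by (simp add: Q_def R_def)
qed

text \<open>For fixed vectors the commutator entry \<open>D\<close> is, up to the factor
  \<open>n\<close>, the derivative at 0 of a polynomial bounded on the circle of radius
  \<open>s / n\<close>. Cauchy's inequality and \<open>n \<rightarrow> \<infinity>\<close> bound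
  \<open>cmod D * s\<close> independently of \<open>s\<close>, hence \<open>D = 0\<close>.\<close>

theorem fuglede:
  fixes N T :: "'a::chilbert_space \<Rightarrow> 'a"
  assumes N: "normal_op N" and T: "bounded_op UNIV UNIV T"
    and TN: "\<And>x. T (N x) = N (T x)"
  shows "T (adj UNIV N x) = adj UNIV N (T x)"
proof -
  let ?N' = "adj UNIV N"
  have bN: "bounded_op UNIV UNIV N" and normal: "?N' (N x) = N (?N' x)" for x
    using N by (auto simp: normal_op_def fun_eq_iff)
  have bN': "bounded_op UNIV UNIV ?N'" by (rule bounded_op_adj_UNIV[OF bN])
  obtain c where c: "c \<ge> 0" "\<And>x. norm (N x) \<le> c * norm x"
    using bounded_op_bound[OF bN] by auto
  have c': "norm (?N' x) \<le> c * norm x" for x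
    by (rule norm_adj_UNIV_le[OF bN c(2)])
  obtain t where t: "t \<ge> 0" "\<And>x. norm (T x) \<le> t * norm x"
    using bounded_op_bound[OF T] by auto
  have "cinner (?N' (T x) - T (?N' x)) y = 0" for y
  proof -
    define D where "D = cinner (T x) (N y) - cinner (T (?N' x)) y"
    \<comment> \<open>This is the bound of \<open>fuglede_estimate\<close> at
      \<open>r = K / n\<close>, with each \<open>(1 + u) ^ n\<close> replaced by
      \<open>exp (n * u)\<close>.\<close>
    define B where "B = (\<lambda>K n. t * norm x * norm y * ((exp (3 * K\<^sup>2 / real n))\<^sup>2
      + (exp K)\<^sup>2 * (exp (K\<^sup>2 / real n) - 1)))"
    have step: "cmod D * s \<le> B (s * c) n" if s: "s > 0" and n: "n > 0" for s n
    proof -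
      obtain p where p: "\<And>a. poly p a = cinner (T (((\<lambda>x. x - a *\<^sub>C ?N' x) ^^ n) x))
          (((\<lambda>x. x + cnj a *\<^sub>C N x) ^^ n) y)"
        "coeff p 1 = of_nat n * cinner (T x) (N y) - of_nat n * cinner (T (?N' x)) y"
        using cinner_funpow_poly[OF bN bN' T, of n x n y] by blast
      \<comment> \<open>The radius \<open>s / n\<close> compensates the factor \<open>n\<close> in
        the derivative \<open>n * D\<close>.\<close>
      have "norm ((deriv ^^ 1) (poly p) 0) \<le> fact 1 * B (s * c) n / (s / real n) ^ 1"
      proof (rule Cauchy_inequality)
        fix a :: complex assume "norm (0 - a) = s / real n"
        then have ra: "cmod a * c = s * c / real n" by simp
        define K where "K = s * c"
        have K: "K \<ge> 0" using s c(1) by (simp add: K_def)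
        have pow: "(1 + u) ^ n \<le> exp (real n * u)" if "u \<ge> 0" for u :: real
          using that power_mono[OF exp_ge_add_one_self[of u], of n] by (simp add: exp_of_nat_mult)
        have "cmod (poly p a) \<le> t * norm x * norm y * (((1 + 3 * (K / real n)\<^sup>2) ^ n)\<^sup>2
            + ((1 + K / real n) ^ n)\<^sup>2 * ((1 + (K / real n)\<^sup>2) ^ n - 1))"
          unfolding p K_def using fuglede_estimate[OF bN bN' T cinner_adj_UNIV[OF bN] normal TN c c' t,
            where a = a and n = n and x = x and y = y] by (simp only: ra)
        also have "\<dots> \<le> t * norm x * norm y * ((exp (real n * (3 * (K / real n)\<^sup>2)))\<^sup>2
            + (exp (real n * (K / real n)))\<^sup>2 * (exp (real n * (K / real n)\<^sup>2) - 1))"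
          using K t(1) by (intro mult_left_mono add_mono mult_mono power_mono diff_mono pow)
            (auto intro!: mult_nonneg_nonneg one_le_power)
        also have "\<dots> = B K n"
          using n by (simp add: B_def power2_eq_square)
        finally show "norm (poly p a) \<le> B (s * c) n" by (simp add: K_def)
      qed (use s n in \<open>auto intro!: continuous_intros holomorphic_intros\<close>)
      moreover have "deriv (poly p) 0 = of_nat n * D"
      proof -
        have "deriv (poly p) 0 = poly (pderiv p) 0"
          by (rule DERIV_imp_deriv) (rule poly_DERIV)
        then show ?thesis
          using p(2) by (simp add: poly_0_coeff_0 coeff_pderiv D_def algebra_simps)
      qed
      ultimately show ?thesis using s n by (simp add: norm_mult field_simps)
    qed
    \<comment> \<open>For fixed \<open>s\<close> the second-order errors vanish as \<open>n\<close>
      grows: the first exponential tends to 1 and the factor of \<open>(exp K)\<^sup>2\<close> tends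
      to 0.\<close>
    have "cmod D * s \<le> t * norm x * norm y" if s: "s > 0" for s
    proof (rule LIMSEQ_le_const)
      have "(\<lambda>n. B (s * c) n) \<longlonglongrightarrow> t * norm x * norm y * ((exp 0)\<^sup>2 + (exp (s * c))\<^sup>2 * (exp 0 - 1))"
        unfolding B_def by (intro tendsto_intros lim_const_over_n)
      then show "B (s * c) \<longlonglongrightarrow> t * norm x * norm y" by simp
      show "\<exists>n0. \<forall>n\<ge>n0. cmod D * s \<le> B (s * c) n"
        using step[OF s] by (intro exI[of _ 1]) auto
    qed
    \<comment> \<open>If \<open>D \<noteq> 0\<close>, this \<open>s\<close> would make the left side
      exceed the right side by 1.\<close>
    from this[of "(t * norm x * norm y + 1) / cmod D"] have "D = 0"
      using t(1) by (cases "D = 0") (auto simp: add_nonneg_pos)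
    then show ?thesis
      using cinner_adj_UNIV[OF bN, of y "T x"] cinner_commute
      unfolding D_def cinner_diff_left
      by (metis)
  qed
  then show ?thesis
    by (metis cinner_eq_zero_iff eq_iff_diff_eq_0)
qed

section \<open>Block matrices and spherical quasinormality\<close>

text \<open>Each operator commutes with its own adjoint by normality and with the adjoint of the
  other by Fuglede's theorem.\<close>

lemma normal_pair_commute:
  fixes N1 N2 :: "'a::chilbert_space \<Rightarrow> 'a"
  assumes "normal_pair N1 N2"
  defines "M \<equiv> \<lambda>x. adj UNIV N1 (N1 x) + adj UNIV N2 (N2 x)"
  shows "N1 (M x) = M (N1 x)" "N2 (M x) = M (N2 x)"
proof -
  have N: "normal_op N1" "normal_op N2" and comm: "N1 (N2 x) = N2 (N1 x)" for x
    using assms(1) by (auto simp: normal_pair_def fun_eq_iff)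
  have b: "bounded_op UNIV UNIV N1" "bounded_op UNIV UNIV N2"
    and normal: "adj UNIV N1 (N1 x) = N1 (adj UNIV N1 x)" "adj UNIV N2 (N2 x) = N2 (adj UNIV N2 x)" for x
    using N by (auto simp: normal_op_def fun_eq_iff)
  have "N1 (adj UNIV N2 x) = adj UNIV N2 (N1 x)" for x
    by (rule fuglede[OF N(2) b(1)]) (rule comm)
  then show "N1 (M x) = M (N1 x)"
    by (simp add: M_def bounded_op_add[OF b(1)] normal(1) comm)
  have "N2 (adj UNIV N1 x) = adj UNIV N1 (N2 x)" for x
    by (rule fuglede[OF N(1) b(2)]) (rule comm[symmetric])
  then show "N2 (M x) = M (N2 x)"
    by (simp add: M_def bounded_op_add[OF b(2)] normal(2) comm)
qed

text \<open>This is the first column of the adjoint block matrix. Tested against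
  \<open>u + v\<close>, the term \<open>D v\<close> drops out because it is orthogonal to
  \<open>y\<close>.\<close>

lemma adj_upper_block:
  fixes H :: "'a::chilbert_space set"
  assumes H: "closed_csubspace H" and N: "bounded_op UNIV UNIV N"
    and T: "bounded_op H H T" and A: "bounded_op (orth_compl H) H A"
    and D: "\<And>v. v \<in> orth_compl H \<Longrightarrow> D v \<in> orth_compl H"
    and block: "upper_block H N T A D" and y: "y \<in> H"
  shows "adj UNIV N y = adj H T y + adj (orth_compl H) A y"
proof -
  note H' = closed_csubspace_orth_compl[of H]
  have orth: "cinner u v = 0" "cinner v u = 0" if "u \<in> H" "v \<in> orth_compl H" for u v
  proof -
    show "cinner u v = 0" using that by (simp add: orth_compl_def)
    then show "cinner v u = 0" by (metis cinner_commute complex_cnj_zero)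
  qed
  have "cinner x (adj UNIV N y) = cinner x (adj H T y + adj (orth_compl H) A y)" for x
  proof -
    obtain u v where uv: "u \<in> H" "v \<in> orth_compl H" "x = u + v"
      using orthogonal_decomposition[OF H] by metis
    have "cinner x (adj UNIV N y) = cinner (T u + A v + D v) y"
      using block uv by (simp add: cinner_adj_UNIV[OF N, symmetric] upper_block_def)
    also have "\<dots> = cinner u (adj H T y) + cinner v (adj (orth_compl H) A y)"
      using uv orth(2)[OF y D] by (simp add: cinner_add_left cinner_adj[OF H T] cinner_adj[OF H' A])
    also have "\<dots> = cinner x (adj H T y + adj (orth_compl H) A y)"
      using uv orth adj_in[OF H T] adj_in[OF H' A] by (simp add: cinner_simps)
    finally show ?thesis .
  qed
  then show ?thesis
    by (metis cinner_commute cinner_left_eqI)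
qed

text \<open>The vector \<open>A v\<close> lies in \<open>H\<close>, and
  \<open>A v = N v - D v\<close> also lies in the orthogonal complement.\<close>

lemma upper_block_corner_eq_0:
  fixes H :: "'a::chilbert_space set"
  assumes H: "closed_csubspace H"
    and T: "bounded_op H H T" and A: "bounded_op (orth_compl H) H A"
    and D: "\<And>v. v \<in> orth_compl H \<Longrightarrow> D v \<in> orth_compl H"
    and block: "upper_block H N T A D"
    and v: "v \<in> orth_compl H" "N v \<in> orth_compl H"
  shows "A v = 0"
proof (rule orth_compl_disjoint)
  show "A v \<in> H" using A v(1) by (simp add: bounded_op_def)
  have H0: "0 \<in> H" using H by (simp add: closed_csubspace_def)
  \<comment> \<open>This gives \<open>T 0 = 0\<close>, so that the block formula at
    \<open>0 + v\<close> reduces to \<open>A v + D v\<close>.\<close>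
  then have "T (0 + 0) = T 0 + T 0" using T unfolding bounded_op_def by blast
  then have "N (0 + v) = A v + D v"
    using block H0 v(1) unfolding upper_block_def by fastforce
  then have "A v = N v - D v" by simp
  then show "A v \<in> orth_compl H"
    using closed_csubspace_diff[OF closed_csubspace_orth_compl v(2) D[OF v(1)]] by simp
qed

theorem theorem2p8:
  fixes H :: "'a::chilbert_space set"
    and T1 T2 N1 N2 A1 A2 B1 B2 :: "'a \<Rightarrow> 'a"
  assumes "closed_csubspace H"
    and "bounded_op H H T1" and "bounded_op H H T2"
    and "normal_extension H T1 T2 N1 N2"
    and "bounded_op (orth_compl H) H A1" and "bounded_op (orth_compl H) H A2"
    and "bounded_op (orth_compl H) (orth_compl H) B1"
    and "bounded_op (orth_compl H) (orth_compl H) B2"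
    and "upper_block H N1 T1 A1 (adj (orth_compl H) B1)"
    and "upper_block H N2 T2 A2 (adj (orth_compl H) B2)"
  shows "spherically_quasinormal H T1 T2 \<longleftrightarrow>
    (\<forall>x\<in>H. adj (orth_compl H) A1 (T1 x) + adj (orth_compl H) A2 (T2 x) = 0)"
proof -
  note H = assms(1) and T1 = assms(2) and T2 = assms(3) and A1 = assms(5) and A2 = assms(6)
    and block1 = assms(9) and block2 = assms(10)
  note H' = closed_csubspace_orth_compl[of H]
  have pair: "normal_pair N1 N2"
    using assms(4) by (simp add: normal_extension_def)
  have T_eq: "T1 x = N1 x" "T2 x = N2 x" if "x \<in> H" for x
    using assms(4) that by (auto simp: normal_extension_def)
  have T_in: "T1 x \<in> H" "T2 x \<in> H" if "x \<in> H" for x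
    using T1 T2 that by (auto simp: bounded_op_def)
  have N1: "bounded_op UNIV UNIV N1" and N2: "bounded_op UNIV UNIV N2"
    and N_comm: "N1 (N2 x) = N2 (N1 x)" for x
    using pair by (auto simp: normal_pair_def normal_op_def fun_eq_iff)
  note D1 = adj_in[OF H' assms(7)] and D2 = adj_in[OF H' assms(8)]
  define P where "P = (\<lambda>x. adj H T1 (T1 x) + adj H T2 (T2 x))"
  define C where "C = (\<lambda>x. adj (orth_compl H) A1 (T1 x) + adj (orth_compl H) A2 (T2 x))"
  define M where "M = (\<lambda>x. adj UNIV N1 (N1 x) + adj UNIV N2 (N2 x))"
  have P_in: "P x \<in> H" for x
    using H adj_in[OF H T1] adj_in[OF H T2] by (simp add: P_def closed_csubspace_def)
  have C_in: "C x \<in> orth_compl H" for x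
    using H' adj_in[OF H' A1] adj_in[OF H' A2] by (simp add: C_def closed_csubspace_def)
  have M_comm: "N1 (M x) = M (N1 x)" "N2 (M x) = M (N2 x)" for x
    unfolding M_def by (rule normal_pair_commute[OF pair])+
  have M_eq: "M x = P x + C x" if x: "x \<in> H" for x
    using adj_upper_block[OF H N1 T1 A1 D1 block1 T_in(1)[OF x]]
      adj_upper_block[OF H N2 T2 A2 D2 block2 T_in(2)[OF x]]
    by (simp add: M_def P_def C_def T_eq[OF x] algebra_simps)
  \<comment> \<open>Commutation of \<open>T1\<close> and \<open>T2\<close> is inherited from
    \<open>N1\<close> and \<open>N2\<close>, so only the conditions on \<open>P\<close>
    remain.\<close>
  have quasi: "spherically_quasinormal H T1 T2
      \<longleftrightarrow> (\<forall>x\<in>H. T1 (P x) = P (T1 x) \<and> T2 (P x) = P (T2 x))"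
    using N_comm T_in T_eq by (auto simp: spherically_quasinormal_def P_def)
  have "(\<forall>x\<in>H. T1 (P x) = P (T1 x) \<and> T2 (P x) = P (T2 x)) \<longleftrightarrow> (\<forall>x\<in>H. C x = 0)"
  proof (intro iffI ballI)
    fix x assume "\<forall>x\<in>H. C x = 0" and x: "x \<in> H"
    then have "M y = P y" if "y \<in> H" for y
      using M_eq that by simp
    then show "T1 (P x) = P (T1 x) \<and> T2 (P x) = P (T2 x)"
      using M_comm[of x] x P_in T_in T_eq by metis
  next
    fix x assume comm: "\<forall>x\<in>H. T1 (P x) = P (T1 x) \<and> T2 (P x) = P (T2 x)" and x: "x \<in> H"
    have "N1 (P x + C x) = P (T1 x) + C (T1 x)" "N2 (P x + C x) = P (T2 x) + C (T2 x)"
      using M_comm[of x] M_eq x T_in T_eq by metis+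
    \<comment> \<open>By hypothesis the terms with \<open>P\<close> cancel. What remains shows that
      \<open>N1\<close> and \<open>N2\<close> map \<open>C x\<close> into the orthogonal complement,
      where the corner lemma applies.\<close>
    then have "N1 (C x) = C (T1 x)" "N2 (C x) = C (T2 x)"
      using comm x T_eq[OF P_in] by (simp_all add: bounded_op_add[OF N1] bounded_op_add[OF N2])
    then have "A1 (C x) = 0" "A2 (C x) = 0"
      using C_in upper_block_corner_eq_0[OF H T1 A1 D1 block1] upper_block_corner_eq_0[OF H T2 A2 D2 block2]
      by simp_all
    \<comment> \<open>Moving the adjoints back turns the sum into inner products of
      \<open>A1 (C x)\<close> with \<open>T1 x\<close> and of \<open>A2 (C x)\<close> with
      \<open>T2 x\<close>, both zero; the right argument is \<open>C x\<close> itself.\<close>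
    then have "cinner (C x) (adj (orth_compl H) A1 (T1 x) + adj (orth_compl H) A2 (T2 x)) = 0"
      by (simp add: cinner_add_right cinner_adj[OF H' A1 C_in, symmetric]
          cinner_adj[OF H' A2 C_in, symmetric])
    then have "cinner (C x) (C x) = 0"
      by (simp add: C_def)
    then show "C x = 0" by simp
  qed
  then show ?thesis
    unfolding quasi by (simp add: C_def)
qed

end
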